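(* Let $L$ be a (left) Leibniz algebra over $\mathfrak{k}$ with left center $Z$, let $H\supseteq Z$ be an isotropic ideal of $L$, and let $(V,\tau)$ be an $H$-representation of $L$. Then $C^{\bullet}(L,H,V)=\bigoplus_{n}C^{n}(L,H,V)$ is a cochain complex under $d=d_{0}+\delta+d'$; that is, $d$ maps $C^{n}(L,H,V)$ into $C^{n+1}(L,H,V)$ for every $n\geq 0$, and $d\circ d=0$.
   Context: Throughout $\mathfrak{k}=\mathbb{R}$ or $\mathbb{C}$; a hat denotes omission. A (left) Leibniz algebra is a $\mathfrak{k}$-vector space $L$ with a bilinear bracket $\circ$ satisfying $e_1\circ(e_2\circ e_3)=(e_1\circ e_2)\circ e_3+e_2\circ(e_1\circ e_3)$. Its left center is $Z=\{e\in L: e\circ e'=0\ \forall e'\in L\}$. The symmetric product $(e_1,e_2)=e_1\circ e_2+e_2\circ e_1$ takes values in $Z$. An isotropic ideal $H$ is a subspace with $e\circ h,\ h\circ e\in H$ for all $e\in L,h\in H$, and $(h,h')=0$ for all $h,h'\in H$. An $H$-representation of $L$ is a vector space $V$ with a linear map $\tau:L\to gl(V)$ such that $\tau(e_1\circ e_2)=[\tau(e_1),\tau(e_2)]$ and $\tau(h)=0$ for all $h\in H$. $C^n(L,H,V)$ is the space of sequences $\omega=(\omega_0,\dots,\omega_{[n/2]})$ of linear maps $\omega_k:(\otimes^{n-2k}L)\otimes(\odot^kH)\to V$ ($\odot^k$ the symmetric power; set $\omega_k=0$ for $k>[n/2]$ or $k<0$) such that for all $k$ and all $i$: $\omega_k(e_1,\dots,e_i,e_{i+1},\dots,e_{n-2k};h_1,\dots,h_k)+\omega_k(e_1,\dots,e_{i+1},e_i,\dots,e_{n-2k};h_1,\dots,h_k)=-\omega_{k+1}(e_1,\dots,\widehat{e_i},\widehat{e_{i+1}},\dots,e_{n-2k};(e_i,e_{i+1}),h_1,\dots,h_k)$.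 For $\omega\in C^n(L,H,V)$ and $0\le k\le[(n+1)/2]$: $(d_0\omega)_k(e_1,\dots,e_{n+1-2k};h_1,\dots,h_k)=\sum_a(-1)^{a+1}\tau(e_a)\omega_k(\dots,\widehat{e_a},\dots;h_1,\dots,h_k)+\sum_{a<b}(-1)^a\omega_k(\dots,\widehat{e_a},\dots,e_a\circ e_b,\dots;h_1,\dots,h_k)$, with $e_a\circ e_b$ in the place of $e_b$ (the Leibniz coboundary with coefficients in $(V,\tau,-\tau)$); $(\delta\omega)_k(e_1,\dots,e_{n+1-2k};h_1,\dots,h_k)=\sum_j\omega_{k-1}(h_j,e_1,\dots,e_{n+1-2k};h_1,\dots,\widehat{h_j},\dots,h_k)$ (zero for $k=0$); $(d'\omega)_k(e_1,\dots,e_{n+1-2k};h_1,\dots,h_k)=\sum_{a,j}(-1)^{a+1}\omega_k(\dots,\widehat{e_a},\dots;h_1,\dots,\widehat{h_j},h_j\circ e_a,\dots,h_k)$, with $h_j\circ e_a$ in the place of $h_j$. *)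

theory Defs
  imports Complex_Main "HOL-Library.Multiset" "HOL-Library.Function_Algebras"
begin

definition real_or_complex_field :: "'k::field itself \<Rightarrow> bool" where
  "real_or_complex_field _ \<longleftrightarrow>
     (\<exists>\<phi> :: 'k \<Rightarrow> real. bij \<phi> \<and> (\<forall>x y. \<phi> (x + y) = \<phi> x + \<phi> y \<and> \<phi> (x * y) = \<phi> x * \<phi> y)) \<or>
     (\<exists>\<phi> :: 'k \<Rightarrow> complex. bij \<phi> \<and> (\<forall>x y. \<phi> (x + y) = \<phi> x + \<phi> y \<and> \<phi> (x * y) = \<phi> x * \<phi> y))"

definition leibniz_algebra ::
  "('k::field \<Rightarrow> 'l::ab_group_add \<Rightarrow> 'l) \<Rightarrow> ('l \<Rightarrow> 'l \<Rightarrow> 'l) \<Rightarrow> bool" where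
  "leibniz_algebra sL br \<longleftrightarrow>
     vector_space sL \<and>
     (\<forall>x. Vector_Spaces.linear sL sL (\<lambda>y. br x y)) \<and>
     (\<forall>y. Vector_Spaces.linear sL sL (\<lambda>x. br x y)) \<and>
     (\<forall>x y z. br x (br y z) = br (br x y) z + br y (br x z))"

definition left_center :: "('l \<Rightarrow> 'l \<Rightarrow> 'l::zero) \<Rightarrow> 'l set" where
  "left_center br = {e. \<forall>e'. br e e' = 0}"

definition sym_prod :: "('l \<Rightarrow> 'l \<Rightarrow> 'l::plus) \<Rightarrow> 'l \<Rightarrow> 'l \<Rightarrow> 'l" where
  "sym_prod br x y = br x y + br y x"

definition isotropic_ideal ::
  "('k::field \<Rightarrow> 'l::ab_group_add \<Rightarrow> 'l) \<Rightarrow> ('l \<Rightarrow> 'l \<Rightarrow> 'l) \<Rightarrow> 'l set \<Rightarrow> bool" where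
  "isotropic_ideal sL br H \<longleftrightarrow>
     module.subspace sL H \<and>
     (\<forall>e. \<forall>h\<in>H. br e h \<in> H \<and> br h e \<in> H) \<and>
     (\<forall>h\<in>H. \<forall>h'\<in>H. sym_prod br h h' = 0)"

definition H_representation ::
  "('k::field \<Rightarrow> 'l::ab_group_add \<Rightarrow> 'l) \<Rightarrow> ('l \<Rightarrow> 'l \<Rightarrow> 'l) \<Rightarrow> 'l set \<Rightarrow>
   ('k \<Rightarrow> 'v::ab_group_add \<Rightarrow> 'v) \<Rightarrow> ('l \<Rightarrow> 'v \<Rightarrow> 'v) \<Rightarrow> bool" where
  "H_representation sL br H sV \<tau> \<longleftrightarrow>
     vector_space sV \<and>
     (\<forall>e. Vector_Spaces.linear sV sV (\<tau> e)) \<and>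
     (\<forall>v. Vector_Spaces.linear sL sV (\<lambda>e. \<tau> e v)) \<and>
     (\<forall>x y v. \<tau> (br x y) v = \<tau> x (\<tau> y v) - \<tau> y (\<tau> x v)) \<and>
     (\<forall>h\<in>H. \<forall>v. \<tau> h v = 0)"

text \<open>
  A sequence of maps is encoded as a function \<open>\<omega>\<close>, where \<open>\<omega> k [e\<^sub>1, \<dots>] [h\<^sub>1, \<dots>, h\<^sub>k]\<close> is the value of
  the \<open>k\<close>-th component.  A linear map on \<open>L\<^bsup>\<otimes>p\<^esup> \<otimes> \<odot>\<^sup>kH\<close> is given by the corresponding map
  on \<open>L\<^sup>p \<times> H\<^sup>k\<close> that is linear in each of the \<open>p + k\<close> arguments and symmetric in the last \<open>k\<close>.
  It is extended by zero to all other lists (wrong lengths, or entries outside \<open>H\<close>), so that each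
  cochain has exactly one encoding and spaces of cochains of different degrees live in one
  function space.
\<close>

type_synonym ('l, 'v) cochain = "nat \<Rightarrow> 'l list \<Rightarrow> 'l list \<Rightarrow> 'v"

text \<open>
  The condition \<open>length es + 2 * k = n\<close> says that there are \<open>n - 2k\<close> arguments from \<open>L\<close>, and
  in particular that \<open>k \<le> [n/2]\<close>.
\<close>

definition cochain_args :: "'l set \<Rightarrow> nat \<Rightarrow> nat \<Rightarrow> 'l list \<Rightarrow> 'l list \<Rightarrow> bool" where
  "cochain_args H n k es hs \<longleftrightarrow> length es + 2 * k = n \<and> length hs = k \<and> set hs \<subseteq> H"

definition cochains ::
  "('k::field \<Rightarrow> 'l::ab_group_add \<Rightarrow> 'l) \<Rightarrow> ('l \<Rightarrow> 'l \<Rightarrow> 'l) \<Rightarrow> 'l set \<Rightarrow>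
   ('k \<Rightarrow> 'v::ab_group_add \<Rightarrow> 'v) \<Rightarrow> nat \<Rightarrow> ('l, 'v) cochain set" where
  "cochains sL br H sV n = {\<omega>.
     (\<forall>k es hs. \<not> cochain_args H n k es hs \<longrightarrow> \<omega> k es hs = 0) \<and>
     (\<forall>k es hs. cochain_args H n k es hs \<longrightarrow>
        (\<forall>i < length es. Vector_Spaces.linear sL sV (\<lambda>x. \<omega> k (es[i := x]) hs)) \<and>
        (\<forall>j < k. \<forall>x\<in>H. \<forall>y\<in>H. \<forall>c.
           \<omega> k es (hs[j := x + y]) = \<omega> k es (hs[j := x]) + \<omega> k es (hs[j := y]) \<and>
           \<omega> k es (hs[j := sL c x]) = sV c (\<omega> k es (hs[j := x]))) \<and>
        (\<forall>hs'. mset hs' = mset hs \<longrightarrow> \<omega> k es hs' = \<omega> k es hs)) \<and>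
     (\<forall>k xs x y ys hs. cochain_args H n k (xs @ [x, y] @ ys) hs \<longrightarrow>
        \<omega> k (xs @ [x, y] @ ys) hs + \<omega> k (xs @ [y, x] @ ys) hs =
          - \<omega> (Suc k) (xs @ ys) (sym_prod br x y # hs))}"

definition omit :: "nat \<Rightarrow> 'a list \<Rightarrow> 'a list" where
  "omit i xs = take i xs @ drop (Suc i) xs"

text \<open>
  List positions start at \<open>0\<close>, so the argument \<open>e\<^sub>a\<close> is \<open>es ! (a - 1)\<close> and the signs
  \<open>(-1)\<^bsup>a+1\<^esup>\<close> and \<open>(-1)\<^sup>a\<close> become \<open>(-1)\<^bsup>i\<^esup>\<close> and \<open>(-1)\<^bsup>i+1\<^esup>\<close> for \<open>i = a - 1\<close>.  The operators do
  not mention the degree: on an element of the \<open>n\<close>-th cochain space the formulas vanish by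
  themselves unless \<open>length es + 2 * k = n + 1\<close>.  Only the condition on \<open>hs\<close> has to be imposed,
  since the formulas for \<open>\<delta>\<close> and \<open>d'\<close> move entries of \<open>hs\<close> out of their slot.
\<close>

definition restrict_args :: "'l set \<Rightarrow> ('l, 'v::zero) cochain \<Rightarrow> ('l, 'v) cochain" where
  "restrict_args H \<omega> = (\<lambda>k es hs. if length hs = k \<and> set hs \<subseteq> H then \<omega> k es hs else 0)"

definition d_zero ::
  "('l \<Rightarrow> 'l \<Rightarrow> 'l) \<Rightarrow> 'l set \<Rightarrow> ('k::field \<Rightarrow> 'v::ab_group_add \<Rightarrow> 'v) \<Rightarrow> ('l \<Rightarrow> 'v \<Rightarrow> 'v) \<Rightarrow>
   ('l, 'v) cochain \<Rightarrow> ('l, 'v) cochain" where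
  "d_zero br H sV \<tau> \<omega> = restrict_args H (\<lambda>k es hs.
     (\<Sum>i<length es. sV ((-1) ^ i) (\<tau> (es ! i) (\<omega> k (omit i es) hs))) +
     (\<Sum>j<length es. \<Sum>i<j.
        sV ((-1) ^ (i + 1)) (\<omega> k (omit i (es[j := br (es ! i) (es ! j)])) hs)))"

definition delta :: "'l set \<Rightarrow> ('l, 'v::ab_group_add) cochain \<Rightarrow> ('l, 'v) cochain" where
  "delta H \<omega> = restrict_args H (\<lambda>k es hs. \<Sum>j<k. \<omega> (k - 1) (hs ! j # es) (omit j hs))"

definition d_prime ::
  "('l \<Rightarrow> 'l \<Rightarrow> 'l) \<Rightarrow> 'l set \<Rightarrow> ('k::field \<Rightarrow> 'v::ab_group_add \<Rightarrow> 'v) \<Rightarrow>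
   ('l, 'v) cochain \<Rightarrow> ('l, 'v) cochain" where
  "d_prime br H sV \<omega> = restrict_args H (\<lambda>k es hs.
     \<Sum>i<length es. \<Sum>j<k.
        sV ((-1) ^ i) (\<omega> k (omit i es) (hs[j := br (hs ! j) (es ! i)])))"

definition differential ::
  "('l \<Rightarrow> 'l \<Rightarrow> 'l) \<Rightarrow> 'l set \<Rightarrow> ('k::field \<Rightarrow> 'v::ab_group_add \<Rightarrow> 'v) \<Rightarrow> ('l \<Rightarrow> 'v \<Rightarrow> 'v) \<Rightarrow>
   ('l, 'v) cochain \<Rightarrow> ('l, 'v) cochain" where
  "differential br H sV \<tau> \<omega> = d_zero br H sV \<tau> \<omega> + delta H \<omega> + d_prime br H sV \<omega>"

definition cochain_scale :: "('k \<Rightarrow> 'v \<Rightarrow> 'v) \<Rightarrow> 'k \<Rightarrow> ('l, 'v) cochain \<Rightarrow> ('l, 'v) cochain" where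
  "cochain_scale sV c \<omega> = (\<lambda>k es hs. sV c (\<omega> k es hs))"

text \<open>
  A cochain complex of vector spaces, for a graded family of subspaces \<open>C n\<close> of one ambient
  space and a map \<open>d\<close> that is linear on each of them.
\<close>

definition cochain_complex ::
  "('k::field \<Rightarrow> 'c::ab_group_add \<Rightarrow> 'c) \<Rightarrow> (nat \<Rightarrow> 'c set) \<Rightarrow> ('c \<Rightarrow> 'c) \<Rightarrow> bool" where
  "cochain_complex s C d \<longleftrightarrow>
     vector_space s \<and>
     (\<forall>n. module.subspace s (C n)) \<and>
     (\<forall>n. \<forall>x\<in>C n. \<forall>y\<in>C n. d (x + y) = d x + d y) \<and>
     (\<forall>n. \<forall>x\<in>C n. \<forall>c. d (s c x) = s c (d x)) \<and>
     (\<forall>n. \<forall>x\<in>C n. d x \<in> C (Suc n)) \<and>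
     (\<forall>n. \<forall>x\<in>C n. d (d x) = 0)"

end

theory Submission
  imports Defs
begin

text \<open>
  The proof is a Cartan calculus.  Let \<open>\<iota>\<^sub>x\<close> insert \<open>x\<close> in the first \<open>L\<close>-slot, \<open>\<kappa>\<^sub>h\<close> insert \<open>h\<close> in the
  first \<open>H\<close>-slot, and let \<open>\<L>\<^sub>x\<close> be the Lie derivative along \<open>x\<close>.  On cochains
  \<open>\<iota>\<^sub>x d + d \<iota>\<^sub>x = \<L>\<^sub>x\<close> and, for \<open>h \<in> H\<close>, \<open>\<kappa>\<^sub>h d - d \<kappa>\<^sub>h = \<iota>\<^sub>h + K\<^sub>h\<close>, where without
  arguments from \<open>L\<close> the operator \<open>K\<^sub>h\<close> vanishes and \<open>d K\<^sub>h = - \<L>\<^sub>h\<close>.  Both \<open>\<iota>\<^sub>x\<close> and \<open>\<kappa>\<^sub>h\<close> are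
  equivariant under \<open>\<L>\<close>, so every identity between \<open>d\<close> and \<open>\<L>\<close> reduces to fewer arguments; in turn
  one gets \<open>[\<L>\<^sub>x, \<L>\<^sub>y] = \<L>\<^bsub>x \<circ> y\<^esub>\<close>, \<open>[\<L>\<^sub>x, d] = 0\<close> and \<open>d\<^sup>2 = 0\<close>.
\<close>

subsection \<open>Lists\<close>

lemma omit_Cons_0 [simp]: "omit 0 (x # xs) = xs"
  and omit_Cons_Suc [simp]: "omit (Suc i) (x # xs) = x # omit i xs"
  by (simp_all add: omit_def)

lemma length_omit [simp]: "i < length xs \<Longrightarrow> length (omit i xs) = length xs - 1"
  by (simp add: omit_def)

lemma mset_update_omit:
  assumes "j < length xs"
  shows "mset (xs[j := x]) = mset (x # omit j xs)"
  using assms by (simp add: upd_conv_take_nth_drop omit_def)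

text \<open>Adjacent transpositions generate the symmetric group: \<open>move\<close> carries the
  occurrence of \<open>x\<close> in \<open>ys\<close> to the front, and the tails are then compared
  behind the common prefix \<open>pre\<close>.\<close>

lemma adjacent_swaps_imp_mset_invariant:
  assumes swap: "\<And>as x y bs. f (as @ x # y # bs) = f (as @ y # x # bs)"
    and "mset xs = mset ys"
  shows "f xs = f ys"
proof -
  have move: "f (pre @ as @ x # bs) = f (pre @ x # as @ bs)" for pre as x bs
  proof (induction as arbitrary: pre)
    case (Cons a as)
    have "f (pre @ (a # as) @ x # bs) = f (pre @ a # x # as @ bs)"
      using Cons.IH[of "pre @ [a]"] by simp
    also have "\<dots> = f (pre @ x # (a # as) @ bs)"
      using swap[of pre a x "as @ bs"] by simp
    finally show ?case .
  qed simp
  have "f (pre @ xs) = f (pre @ ys)" if "mset xs = mset ys" for pre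
    using that
  proof (induction xs arbitrary: ys pre)
    case (Cons x xs)
    then have "x \<in> set ys"
      by (metis list.set_intros(1) mset_eq_setD)
    then obtain as bs where ys: "ys = as @ x # bs"
      by (meson split_list)
    with Cons.prems have "mset xs = mset (as @ bs)" by simp
    from Cons.IH[OF this, of "pre @ [x]"] show ?case
      by (simp add: ys move)
  qed simp
  from this[of "[]"] assms(2) show ?thesis by simp
qed

subsection \<open>Contractions and Lie derivatives\<close>

definition iota :: "'l \<Rightarrow> ('l, 'v) cochain \<Rightarrow> ('l, 'v) cochain" where
  "iota x \<omega> = (\<lambda>k es hs. \<omega> k (x # es) hs)"

definition kappa :: "'l \<Rightarrow> ('l, 'v) cochain \<Rightarrow> ('l, 'v) cochain" where
  "kappa h \<omega> = (\<lambda>k es hs. \<omega> (Suc k) es (h # hs))"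

lemma iota_apply: "iota x \<omega> k es hs = \<omega> k (x # es) hs"
  and kappa_apply: "kappa h \<omega> k es hs = \<omega> (Suc k) es (h # hs)"
  by (simp_all add: iota_def kappa_def)

lemma cochain_scale_apply: "cochain_scale sV c \<omega> k es hs = sV c (\<omega> k es hs)"
  by (simp add: cochain_scale_def)

locale leibniz_representation =
  L: vector_space sL + V: vector_space sV
  for sL :: "'k::field \<Rightarrow> 'l::ab_group_add \<Rightarrow> 'l"
    and sV :: "'k \<Rightarrow> 'v::ab_group_add \<Rightarrow> 'v" +
  fixes br :: "'l \<Rightarrow> 'l \<Rightarrow> 'l"
    and H :: "'l set"
    and \<tau> :: "'l \<Rightarrow> 'v \<Rightarrow> 'v"
  assumes br_add_left: "br (x + y) z = br x z + br y z"
    and br_scale_left: "br (sL c x) z = sL c (br x z)"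
    and br_add_right: "br z (x + y) = br z x + br z y"
    and br_scale_right: "br z (sL c x) = sL c (br z x)"
    and leibniz: "br x (br y z) = br (br x y) z + br y (br x z)"
    and subspace_H: "L.subspace H"
    and br_H: "h \<in> H \<Longrightarrow> br x h \<in> H" "h \<in> H \<Longrightarrow> br h x \<in> H"
    and left_center_H: "left_center br \<subseteq> H"
    and tau_add: "\<tau> x (v + w) = \<tau> x v + \<tau> x w"
    and tau_scale: "\<tau> x (sV c v) = sV c (\<tau> x v)"
    and tau_add_left: "\<tau> (x + y) v = \<tau> x v + \<tau> y v"
    and tau_scale_left: "\<tau> (sL c x) v = sV c (\<tau> x v)"
    and tau_br: "\<tau> (br x y) v = \<tau> x (\<tau> y v) - \<tau> y (\<tau> x v)"
    and tau_H: "h \<in> H \<Longrightarrow> \<tau> h v = 0"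
begin

abbreviation d :: "('l, 'v) cochain \<Rightarrow> ('l, 'v) cochain" where
  "d \<equiv> differential br H sV \<tau>"

abbreviation smul :: "'k \<Rightarrow> ('l, 'v) cochain \<Rightarrow> ('l, 'v) cochain" where
  "smul \<equiv> cochain_scale sV"

text \<open>The action of left multiplication by \<open>x\<close> on multilinear maps. The
  restriction matters because \<open>br x\<close> may turn an entry outside \<open>H\<close> into
  one inside \<open>H\<close>.\<close>

definition Lie :: "'l \<Rightarrow> ('l, 'v) cochain \<Rightarrow> ('l, 'v) cochain" where
  "Lie x \<omega> = restrict_args H (\<lambda>k es hs. \<tau> x (\<omega> k es hs)
     - (\<Sum>i<length es. \<omega> k (es[i := br x (es ! i)]) hs)
     - (\<Sum>j<k. \<omega> k es (hs[j := br x (hs ! j)])))"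

text \<open>Collects the summands of \<open>d_prime\<close> on \<open>h # hs\<close> in which the
  slot of \<open>h\<close> is the one that changes.\<close>

definition K :: "'l \<Rightarrow> ('l, 'v) cochain \<Rightarrow> ('l, 'v) cochain" where
  "K h \<omega> = (\<lambda>k es hs. \<Sum>i<length es.
     sV ((-1) ^ i) (\<omega> (Suc k) (omit i es) (br h (es ! i) # hs)))"

lemma tau_zero [simp]: "\<tau> x 0 = 0"
  using tau_add[of x 0 0] by simp

text \<open>By the Leibniz identity (x \<circ> y) \<circ> z is the commutator of left
  multiplications by x and y applied to z, hence antisymmetric in x and y.\<close>

lemma sym_prod_left_center: "br (sym_prod br x y) z = 0"
  using leibniz[of x y z] leibniz[of y x z] by (simp add: sym_prod_def br_add_left)

lemma sym_prod_H: "sym_prod br x y \<in> H"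
  using left_center_H sym_prod_left_center by (auto simp: left_center_def)

text \<open>The form \<open>sL c x + y\<close> is used throughout, so that additivity and
  homogeneity are proved together.\<close>

lemma lin_H: "x \<in> H \<Longrightarrow> y \<in> H \<Longrightarrow> sL c x + y \<in> H"
  using subspace_H by (simp add: L.subspace_add L.subspace_scale)

lemma br_lin_left: "br (sL c x + y) z = sL c (br x z) + br y z"
  and br_lin_right: "br z (sL c x + y) = sL c (br z x) + br z y"
  by (simp_all add: br_add_left br_add_right br_scale_left br_scale_right)

subsection \<open>Linearity of the operators\<close>

lemma d_apply:
  "d \<omega> k es hs = (if length hs = k \<and> set hs \<subseteq> H then
     (\<Sum>i<length es. sV ((-1) ^ i) (\<tau> (es ! i) (\<omega> k (omit i es) hs))) +
     (\<Sum>j<length es. \<Sum>i<j.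
        sV ((-1) ^ (i + 1)) (\<omega> k (omit i (es[j := br (es ! i) (es ! j)])) hs)) +
     (\<Sum>j<k. \<omega> (k - 1) (hs ! j # es) (omit j hs)) +
     (\<Sum>i<length es. \<Sum>j<k.
        sV ((-1) ^ i) (\<omega> k (omit i es) (hs[j := br (hs ! j) (es ! i)]))) else 0)"
  by (simp add: differential_def d_zero_def delta_def d_prime_def restrict_args_def)

lemma Lie_apply:
  "Lie x \<omega> k es hs = (if length hs = k \<and> set hs \<subseteq> H then \<tau> x (\<omega> k es hs)
     - (\<Sum>i<length es. \<omega> k (es[i := br x (es ! i)]) hs)
     - (\<Sum>j<k. \<omega> k es (hs[j := br x (hs ! j)])) else 0)"
  by (simp add: Lie_def restrict_args_def)

lemma d_add: "d (\<omega> + \<omega>') = d \<omega> + d \<omega>'"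
  by (intro ext) (simp add: d_apply tau_add V.scale_right_distrib sum.distrib sum_subtractf sum_negf)

lemma d_scale: "d (smul c \<omega>) = smul c (d \<omega>)"
  by (intro ext)
    (simp add: d_apply cochain_scale_apply tau_scale V.scale_right_distrib V.scale_sum_right
      mult.commute[of c])

lemma Lie_add: "Lie x (\<omega> + \<omega>') = Lie x \<omega> + Lie x \<omega>'"
  by (intro ext) (simp add: Lie_apply tau_add sum.distrib)

lemma Lie_scale: "Lie x (smul c \<omega>) = smul c (Lie x \<omega>)"
  by (intro ext)
    (simp add: Lie_apply cochain_scale_apply tau_scale V.scale_right_diff_distrib V.scale_sum_right)

lemma d_diff: "d (\<omega> - \<omega>') = d \<omega> - d \<omega>'"
  using d_add[of "\<omega> - \<omega>'" \<omega>'] by (simp add: algebra_simps)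

lemma Lie_diff: "Lie x (\<omega> - \<omega>') = Lie x \<omega> - Lie x \<omega>'"
  using Lie_add[of x "\<omega> - \<omega>'" \<omega>'] by (simp add: algebra_simps)

lemma d_minus: "d (- \<omega>) = - d \<omega>"
  using d_diff[of \<omega> \<omega>] d_diff[of "\<omega> - \<omega>" \<omega>] by simp

lemma Lie_minus: "Lie x (- \<omega>) = - Lie x \<omega>"
  using Lie_diff[of x \<omega> \<omega>] Lie_diff[of x "\<omega> - \<omega>" \<omega>] by simp

subsection \<open>Cochains of mixed degree\<close>

text \<open>
  The product of all cochain spaces.  Without the degree the contractions preserve
  the predicate, and induction runs over the arguments alone.
\<close>

definition mixed :: "('l, 'v) cochain \<Rightarrow> bool" where
  "mixed \<omega> \<longleftrightarrow>
     (\<forall>k es hs. \<not> (length hs = k \<and> set hs \<subseteq> H) \<longrightarrow> \<omega> k es hs = 0) \<and>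
     (\<forall>k xs ys hs c x y. \<omega> k (xs @ (sL c x + y) # ys) hs =
        sV c (\<omega> k (xs @ x # ys) hs) + \<omega> k (xs @ y # ys) hs) \<and>
     (\<forall>k es hs c x y. x \<in> H \<longrightarrow> y \<in> H \<longrightarrow> \<omega> k es ((sL c x + y) # hs) =
        sV c (\<omega> k es (x # hs)) + \<omega> k es (y # hs)) \<and>
     (\<forall>k es as x y bs. \<omega> k es (as @ x # y # bs) = \<omega> k es (as @ y # x # bs)) \<and>
     (\<forall>k xs x y ys hs. \<omega> k (xs @ x # y # ys) hs + \<omega> k (xs @ y # x # ys) hs =
        - \<omega> (Suc k) (xs @ ys) (sym_prod br x y # hs))"

text \<open>Wherever the support condition makes both sides 0, linearity and symmetry in the
  \<open>H\<close>-slots are automatic. What remains has entries in \<open>H\<close>, as the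
  recursion rules for \<open>Lie\<close> and \<open>d\<close> require.\<close>

lemma mixedI:
  assumes "\<And>k es hs. \<not> (length hs = k \<and> set hs \<subseteq> H) \<Longrightarrow> \<omega> k es hs = 0"
    and "\<And>k xs ys hs c x y. \<omega> k (xs @ (sL c x + y) # ys) hs =
        sV c (\<omega> k (xs @ x # ys) hs) + \<omega> k (xs @ y # ys) hs"
    and "\<And>k es hs c x y. x \<in> H \<Longrightarrow> y \<in> H \<Longrightarrow> \<omega> (Suc k) es ((sL c x + y) # hs) =
        sV c (\<omega> (Suc k) es (x # hs)) + \<omega> (Suc k) es (y # hs)"
    and "\<And>k es as x y bs. x \<in> H \<Longrightarrow> y \<in> H \<Longrightarrow> set as \<subseteq> H \<Longrightarrow> k = length as + Suc (Suc (length bs)) \<Longrightarrow>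
        \<omega> k es (as @ x # y # bs) = \<omega> k es (as @ y # x # bs)"
    and "\<And>k xs x y ys hs. \<omega> k (xs @ x # y # ys) hs + \<omega> k (xs @ y # x # ys) hs =
        - \<omega> (Suc k) (xs @ ys) (sym_prod br x y # hs)"
  shows "mixed \<omega>"
proof -
  have "\<omega> k es ((sL c x + y) # hs) = sV c (\<omega> k es (x # hs)) + \<omega> k es (y # hs)"
    if "x \<in> H" "y \<in> H" for k es hs c x y
    using assms(1)[where k = k] assms(3)[OF that] by (cases k) simp_all
  moreover have "\<omega> k es (as @ x # y # bs) = \<omega> k es (as @ y # x # bs)" for k es as x y bs
  proof (cases "length (as @ x # y # bs) = k \<and> set (as @ x # y # bs) \<subseteq> H")
    case False
    then show ?thesis
      by (subst (1 2) assms(1)) auto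
  qed (use assms(4) in auto)
  ultimately show ?thesis
    unfolding mixed_def using assms(1,2,5) by (intro conjI allI impI)
qed

lemma mixed_support: "mixed \<omega> \<Longrightarrow> \<not> (length hs = k \<and> set hs \<subseteq> H) \<Longrightarrow> \<omega> k es hs = 0"
  unfolding mixed_def by (elim conjE) simp

lemma mixed_lin: "mixed \<omega> \<Longrightarrow>
    \<omega> k (xs @ (sL c x + y) # ys) hs = sV c (\<omega> k (xs @ x # ys) hs) + \<omega> k (xs @ y # ys) hs"
  unfolding mixed_def by (elim conjE) simp

lemma mixed_lin_H: "mixed \<omega> \<Longrightarrow> x \<in> H \<Longrightarrow> y \<in> H \<Longrightarrow>
    \<omega> k es ((sL c x + y) # hs) = sV c (\<omega> k es (x # hs)) + \<omega> k es (y # hs)"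
  unfolding mixed_def by (elim conjE) simp

lemma mixed_swap: "mixed \<omega> \<Longrightarrow> \<omega> k es (as @ x # y # bs) = \<omega> k es (as @ y # x # bs)"
  unfolding mixed_def by (elim conjE) simp

lemma mixed_skew: "mixed \<omega> \<Longrightarrow> \<omega> k (xs @ x # y # ys) hs + \<omega> k (xs @ y # x # ys) hs =
    - \<omega> (Suc k) (xs @ ys) (sym_prod br x y # hs)"
  unfolding mixed_def by (elim conjE) simp

lemma mixed_mset: "mixed \<omega> \<Longrightarrow> mset hs = mset hs' \<Longrightarrow> \<omega> k es hs = \<omega> k es hs'"
  by (rule adjacent_swaps_imp_mset_invariant[where f = "\<omega> k es"]) (simp_all add: mixed_swap)

text \<open>Symmetry moves a changed entry to the front, so that laws for the first
  \<open>H\<close>-slot apply to every slot.\<close>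

lemma mixed_update:
  "mixed \<omega> \<Longrightarrow> j < length hs \<Longrightarrow> \<omega> k es (hs[j := x]) = \<omega> k es (x # omit j hs)"
  by (rule mixed_mset) (simp_all add: mset_update_omit)

lemma mixed_zero_H:
  assumes "mixed \<omega>" shows "\<omega> k es (0 # hs) = 0"
proof -
  have "(0::'l) \<in> H" using subspace_H by (rule L.subspace_0)
  from mixed_lin_H[OF assms this this, of k es 1 hs] show ?thesis by simp
qed

lemma mixed_add_H: "mixed \<omega> \<Longrightarrow> x \<in> H \<Longrightarrow> y \<in> H \<Longrightarrow>
    \<omega> k es ((x + y) # hs) = \<omega> k es (x # hs) + \<omega> k es (y # hs)"
  using mixed_lin_H[of \<omega> x y k es 1 hs] by simp

lemma mixed_iota:
  assumes "mixed \<omega>" shows "mixed (iota x \<omega>)"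
proof (rule mixedI)
  show "iota x \<omega> k (xs @ (sL c u + y) # ys) hs =
      sV c (iota x \<omega> k (xs @ u # ys) hs) + iota x \<omega> k (xs @ y # ys) hs" for k xs ys hs c u y
    using mixed_lin[OF assms, of k "x # xs"] by (simp add: iota_apply)
  show "iota x \<omega> k (xs @ u # y # ys) hs + iota x \<omega> k (xs @ y # u # ys) hs =
      - iota x \<omega> (Suc k) (xs @ ys) (sym_prod br u y # hs)" for k xs ys hs u y
    using mixed_skew[OF assms, of k "x # xs"] by (simp add: iota_apply)
qed (simp_all only: iota_apply mixed_support[OF assms] mixed_lin_H[OF assms] mixed_swap[OF assms]
    not_False_eq_True)

text \<open>The inserted \<open>h\<close> takes the first \<open>H\<close>-slot; swapping it with
  its neighbour frees that slot for the linear argument or for the symmetric product.\<close>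

lemma mixed_kappa:
  assumes "mixed \<omega>" "h \<in> H" shows "mixed (kappa h \<omega>)"
proof (rule mixedI)
  show "kappa h \<omega> (Suc k) es ((sL c x + y) # hs) =
      sV c (kappa h \<omega> (Suc k) es (x # hs)) + kappa h \<omega> (Suc k) es (y # hs)"
    if "x \<in> H" "y \<in> H" for k es hs c x y
    using mixed_swap[OF assms(1), of _ _ "[]" h] mixed_lin_H[OF assms(1) that]
    by (simp add: kappa_apply)
  show "kappa h \<omega> k es (as @ x # y # bs) = kappa h \<omega> k es (as @ y # x # bs)" for k es as x y bs
    using mixed_swap[OF assms(1), of "Suc k" es "h # as"] by (simp add: kappa_apply)
  show "kappa h \<omega> k (xs @ x # y # ys) hs + kappa h \<omega> k (xs @ y # x # ys) hs =
      - kappa h \<omega> (Suc k) (xs @ ys) (sym_prod br x y # hs)" for k xs ys hs x y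
    using mixed_skew[OF assms(1), of "Suc k" xs x y ys "h # hs"]
      mixed_swap[OF assms(1), of _ _ "[]" h] by (simp add: kappa_apply)
qed (use assms in \<open>simp_all add: kappa_apply mixed_support mixed_lin\<close>)

lemma iota_lin: "mixed \<omega> \<Longrightarrow> iota (sL c x + y) \<omega> = smul c (iota x \<omega>) + iota y \<omega>"
  using mixed_lin[of \<omega> _ "[]"] by (simp add: fun_eq_iff iota_apply cochain_scale_apply)

lemma kappa_lin: "mixed \<omega> \<Longrightarrow> x \<in> H \<Longrightarrow> y \<in> H \<Longrightarrow>
    kappa (sL c x + y) \<omega> = smul c (kappa x \<omega>) + kappa y \<omega>"
  by (simp add: fun_eq_iff kappa_apply cochain_scale_apply mixed_lin_H)

lemma iota_sum: "mixed \<omega> \<Longrightarrow> iota (x + y) \<omega> = iota x \<omega> + iota y \<omega>"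
  using iota_lin[of \<omega> 1 x y] by (simp add: fun_eq_iff cochain_scale_apply)

lemma kappa_commute: "mixed \<omega> \<Longrightarrow> kappa g (kappa h \<omega>) = kappa h (kappa g \<omega>)"
  using mixed_swap[of \<omega> _ _ "[]"] by (simp add: fun_eq_iff kappa_apply)

text \<open>Weak skew-symmetry in the first two slots, read as a relation between operators, to both
  sides of which \<open>Lie\<close> and \<open>d\<close> can be applied.\<close>

lemma iota_skew:
  "mixed \<omega> \<Longrightarrow> iota y (iota x \<omega>) + iota x (iota y \<omega>) = - kappa (sym_prod br x y) \<omega>"
  using mixed_skew[of \<omega> _ "[]"] by (simp add: fun_eq_iff iota_apply kappa_apply)


subsection \<open>Cartan formulas\<close>

text \<open>The slot of \<open>e\<close> is the summand i = 0 of the sum over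
  \<open>L\<close>-slots; the others form \<open>Lie x (iota e \<omega>)\<close>. Support is needed
  where \<open>Lie\<close> is cut off.\<close>

lemma iota_Lie:
  assumes "mixed \<omega>"
  shows "iota e (Lie x \<omega>) = Lie x (iota e \<omega>) - iota (br x e) \<omega>"
proof (intro ext)
  fix k es hs
  show "iota e (Lie x \<omega>) k es hs = (Lie x (iota e \<omega>) - iota (br x e) \<omega>) k es hs"
    using mixed_support[OF assms]
    by (simp add: Lie_apply iota_apply sum.lessThan_Suc_shift del: sum.lessThan_Suc)
qed

lemma kappa_Lie:
  assumes "mixed \<omega>" "h \<in> H"
  shows "kappa h (Lie x \<omega>) = Lie x (kappa h \<omega>) - kappa (br x h) \<omega>"
proof (intro ext)
  fix k es hs
  show "kappa h (Lie x \<omega>) k es hs = (Lie x (kappa h \<omega>) - kappa (br x h) \<omega>) k es hs"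
    using mixed_support[OF assms(1)] assms(2)
    by (simp add: Lie_apply kappa_apply sum.lessThan_Suc_shift del: sum.lessThan_Suc)
qed

text \<open>The summands j = 0 give \<open>iota h \<omega>\<close> in \<open>delta\<close> and
  \<open>K h \<omega>\<close> in \<open>d_prime\<close>; the rest is
  \<open>d (kappa h \<omega>)\<close>.\<close>

lemma kappa_d:
  assumes "mixed \<omega>" "h \<in> H"
  shows "kappa h (d \<omega>) = d (kappa h \<omega>) + iota h \<omega> + K h \<omega>"
proof (intro ext)
  fix k es hs
  show "kappa h (d \<omega>) k es hs = (d (kappa h \<omega>) + iota h \<omega> + K h \<omega>) k es hs"
  proof (cases "length hs = k \<and> set hs \<subseteq> H")
    case True
    then show ?thesis
      using assms(2)
      \<comment> \<open>In \<open>delta\<close> of \<open>kappa h \<omega>\<close> the index is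
        \<open>Suc (k - 1)\<close>, which is \<open>k\<close> unless \<open>k = 0\<close>, and then
        the sum is empty.\<close>
      by (cases k) (simp_all add: d_apply K_def iota_apply kappa_apply sum.lessThan_Suc_shift
          sum.distrib V.scale_right_distrib algebra_simps del: sum.lessThan_Suc)
  next
    case False
    then have "iota h \<omega> k es hs = 0" "K h \<omega> k es hs = 0"
      using mixed_support[OF assms(1)] by (simp_all add: iota_apply K_def)
    then show ?thesis
      using False by (auto simp: d_apply kappa_apply)
  qed
qed

text \<open>In \<open>d_zero\<close> the terms where e is the acting argument give the \<tau>-part
  and the \<open>L\<close>-slot part of \<open>Lie e\<close>. The \<open>H\<close>-slot part comes
  from moving e past the argument inserted by \<open>delta\<close>.\<close>

lemma iota_d:
  assumes "mixed \<omega>"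
  shows "iota e (d \<omega>) = Lie e \<omega> - d (iota e \<omega>)"
proof (intro ext)
  fix k es hs
  show "iota e (d \<omega>) k es hs = (Lie e \<omega> - d (iota e \<omega>)) k es hs"
  proof (cases "length hs = k \<and> set hs \<subseteq> H")
    case True
    \<comment> \<open>Weak skew-symmetry leaves the entry (h, e) = h \<circ> e + e \<circ> h, with h
      for \<open>hs ! j\<close>. Its first half cancels the summand i = 0 of \<open>d_prime\<close>,
      its second half belongs to \<open>Lie e\<close>.\<close>
    have "\<omega> (k - 1) (hs ! j # e # es) (omit j hs) = - \<omega> (k - 1) (e # hs ! j # es) (omit j hs)
        - \<omega> k es (hs[j := br (hs ! j) e]) - \<omega> k es (hs[j := br e (hs ! j)])" if "j < k" for j
    proof -
      have "hs ! j \<in> H" using that True by auto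
      then have "\<omega> k es (sym_prod br (hs ! j) e # omit j hs) =
          \<omega> k es (hs[j := br (hs ! j) e]) + \<omega> k es (hs[j := br e (hs ! j)])"
        using that True by (simp add: sym_prod_def mixed_add_H[OF assms] br_H mixed_update[OF assms])
      with mixed_skew[OF assms, of "k - 1" "[]" "hs ! j" e es "omit j hs"] that show ?thesis
        by (simp add: algebra_simps eq_neg_iff_add_eq_0)
    qed
    then have *: "(\<Sum>j<k. \<omega> (k - 1) (hs ! j # e # es) (omit j hs)) =
        (\<Sum>j<k. - \<omega> (k - 1) (e # hs ! j # es) (omit j hs)
        - \<omega> k es (hs[j := br (hs ! j) e]) - \<omega> k es (hs[j := br e (hs ! j)]))"
      by (intro sum.cong) simp_all
    show ?thesis
      using True
      by (simp add: d_apply Lie_apply iota_apply sum.lessThan_Suc_shift * sum.distrib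
          sum_subtractf sum_negf algebra_simps del: sum.lessThan_Suc One_nat_def)
  next
    case False
    then show ?thesis
      by (simp only: d_apply Lie_apply iota_apply minus_apply if_False diff_self)
  qed
qed

section \<open>Recursion and induction over the arguments\<close>

lemma Lie_Cons:
  "mixed \<omega> \<Longrightarrow> Lie x \<omega> k (e # es) hs = Lie x (iota e \<omega>) k es hs - \<omega> k (br x e # es) hs"
  using iota_Lie[of \<omega> e x] by (simp add: fun_eq_iff iota_apply)

lemma Lie_Cons_H:
  "mixed \<omega> \<Longrightarrow> h \<in> H \<Longrightarrow>
    Lie x \<omega> (Suc k) es (h # hs) = Lie x (kappa h \<omega>) k es hs - \<omega> (Suc k) es (br x h # hs)"
  using kappa_Lie[of \<omega> h x] by (simp add: fun_eq_iff kappa_apply)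

lemma d_Cons:
  "mixed \<omega> \<Longrightarrow> d \<omega> k (e # es) hs = Lie e \<omega> k es hs - d (iota e \<omega>) k es hs"
  using iota_d[of \<omega> e] by (simp add: fun_eq_iff iota_apply)

lemma d_Cons_H:
  "mixed \<omega> \<Longrightarrow> h \<in> H \<Longrightarrow>
    d \<omega> (Suc k) es (h # hs) = d (kappa h \<omega>) k es hs + \<omega> k (h # es) hs + K h \<omega> k es hs"
  using kappa_d[of \<omega> h] by (simp add: fun_eq_iff kappa_apply iota_apply)

text \<open>All \<open>L\<close>-arguments are removed before any \<open>H\<close>-argument, so the
  case \<open>kappa\<close> has no \<open>L\<close>-arguments and \<open>K\<close> vanishes there.
  The cochain varies, since each contraction replaces it.\<close>

lemma mixed_induct [consumes 1, case_names support nil iota kappa]: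
  assumes "mixed \<omega>"
    and "\<And>\<omega> k es hs. mixed \<omega> \<Longrightarrow> \<not> (length hs = k \<and> set hs \<subseteq> H) \<Longrightarrow> Q \<omega> k es hs"
    and "\<And>\<omega>. mixed \<omega> \<Longrightarrow> Q \<omega> 0 [] []"
    and "\<And>\<omega> k x es hs. mixed \<omega> \<Longrightarrow> Q (iota x \<omega>) k es hs \<Longrightarrow> Q \<omega> k (x # es) hs"
    and "\<And>\<omega> k h hs. mixed \<omega> \<Longrightarrow> h \<in> H \<Longrightarrow> Q (kappa h \<omega>) k [] hs \<Longrightarrow> Q \<omega> (Suc k) [] (h # hs)"
  shows "Q \<omega> k es hs"
  using assms(1)
proof (induction es arbitrary: \<omega>)
  case Nil
  then show ?case
  proof (induction hs arbitrary: \<omega> k)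
    case Nil
    then show ?case using assms(2,3) by (cases k) auto
  next
    case (Cons h hs)
    show ?case
    proof (cases "length (h # hs) = k \<and> set (h # hs) \<subseteq> H")
      case True
      then show ?thesis
        using Cons assms(5) mixed_kappa by (cases k) auto
    qed (use Cons assms(2) in blast)
  qed
next
  case (Cons x es)
  then show ?case using assms(4) mixed_iota by blast
qed

text \<open>Subtracts two instances of weak skew-symmetry, as the recursions for \<open>Lie\<close>
  and \<open>d\<close> demand.\<close>

lemma skew_diff:
  fixes a :: "'v"
  assumes "a + b = - c" "a' + b' = - c'"
  shows "a - a' + (b - b') = - (c - c')"
proof -
  have "a - a' + (b - b') = (a + b) - (a' + b')" by simp
  also have "\<dots> = - (c - c')" unfolding assms by simp
  finally show ?thesis .
qed

section \<open>Lie derivatives as operators on mixed cochains\<close>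

lemma mixed_Lie:
  assumes "mixed \<omega>" shows "mixed (Lie z \<omega>)"
proof (rule mixedI)
  show "Lie z \<omega> k es hs = 0" if "\<not> (length hs = k \<and> set hs \<subseteq> H)" for k es hs
    unfolding Lie_apply using that by (rule if_not_P)
  show "Lie z \<omega> k (xs @ (sL c x + y) # ys) hs =
      sV c (Lie z \<omega> k (xs @ x # ys) hs) + Lie z \<omega> k (xs @ y # ys) hs" for k xs ys hs c x y
    using assms
  proof (induction xs arbitrary: \<omega>)
    case Nil
    then show ?case
      using mixed_lin[of \<omega> k "[]"]
      by (simp add: Lie_Cons iota_lin Lie_add Lie_scale br_lin_right cochain_scale_apply
          V.scale_right_diff_distrib)
  next
    case (Cons w xs)
    then show ?case
      using mixed_lin[of \<omega> k "br z w # xs"]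
      by (simp add: Lie_Cons mixed_iota V.scale_right_diff_distrib)
  qed
  show "Lie z \<omega> (Suc k) es ((sL c x + y) # hs) =
      sV c (Lie z \<omega> (Suc k) es (x # hs)) + Lie z \<omega> (Suc k) es (y # hs)"
    if "x \<in> H" "y \<in> H" for k es hs c x y
    using assms that
    by (simp add: Lie_Cons_H lin_H kappa_lin Lie_add Lie_scale br_lin_right cochain_scale_apply
        mixed_lin_H br_H V.scale_right_diff_distrib)
  show "Lie z \<omega> k es (as @ x # y # bs) = Lie z \<omega> k es (as @ y # x # bs)"
    if "x \<in> H" "y \<in> H" "set as \<subseteq> H" "k = length as + Suc (Suc (length bs))" for k es as x y bs
    using assms that(3,4)
  proof (induction as arbitrary: \<omega> k)
    case Nil
    then show ?case
      using that(1,2) kappa_commute[of \<omega> x y] mixed_swap[of \<omega> _ _ "[]" "br z x"]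
        mixed_swap[of \<omega> _ _ "[]" x "br z y"]
      by (simp add: Lie_Cons_H mixed_kappa kappa_apply)
  next
    case (Cons a as)
    then show ?case
      using mixed_swap[of \<omega> k es "br z a # as" x y bs] by (simp add: Lie_Cons_H mixed_kappa)
  qed
  show "Lie z \<omega> k (xs @ x # y # ys) hs + Lie z \<omega> k (xs @ y # x # ys) hs =
      - Lie z \<omega> (Suc k) (xs @ ys) (sym_prod br x y # hs)" for k xs x y ys hs
    using assms
  proof (induction xs arbitrary: \<omega>)
    case Nil
    have skew: "\<omega> k (br z x # y # ys) hs =
        - \<omega> (Suc k) ys (sym_prod br (br z x) y # hs) - \<omega> k (y # br z x # ys) hs"
      "\<omega> k (x # br z y # ys) hs =
        - \<omega> (Suc k) ys (sym_prod br x (br z y) # hs) - \<omega> k (br z y # x # ys) hs"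
      using mixed_skew[OF Nil, of k "[]"] by (simp_all add: eq_diff_eq)
    \<comment> \<open>Left multiplication by \<open>z\<close> is a derivation of the bracket, hence
      of the symmetric product; this supplies the correction term in the
      \<open>H\<close>-slot.\<close>
    have "br z (sym_prod br x y) = sym_prod br (br z x) y + sym_prod br x (br z y)"
      using leibniz[of z x y] leibniz[of z y x] by (simp add: sym_prod_def br_add_right algebra_simps)
    then have "\<omega> (Suc k) ys (br z (sym_prod br x y) # hs) =
        \<omega> (Suc k) ys (sym_prod br (br z x) y # hs) + \<omega> (Suc k) ys (sym_prod br x (br z y) # hs)"
      using Nil by (simp add: mixed_add_H sym_prod_H)
    moreover have "Lie z (iota y (iota x \<omega>)) k ys hs + Lie z (iota x (iota y \<omega>)) k ys hs =
        - Lie z (kappa (sym_prod br x y) \<omega>) k ys hs"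
      using arg_cong[OF iota_skew[OF Nil, of y x], of "\<lambda>\<psi>. Lie z \<psi> k ys hs"]
      by (simp add: Lie_add Lie_minus)
    ultimately show ?case
      using Nil
      by (simp add: skew Lie_Cons Lie_Cons_H mixed_iota sym_prod_H iota_apply algebra_simps)
  next
    case (Cons w xs)
    from skew_diff[OF Cons.IH[OF mixed_iota[OF Cons.prems], of w]
        mixed_skew[OF Cons.prems, of k "br z w # xs" x y ys hs]]
    show ?case by (simp add: Lie_Cons Cons.prems)
  qed
qed

lemma Lie_lin_left:
  assumes "mixed \<omega>"
  shows "Lie (sL c x + y) \<omega> = smul c (Lie x \<omega>) + Lie y \<omega>"
proof (intro ext)
  show "Lie (sL c x + y) \<omega> k es hs = (smul c (Lie x \<omega>) + Lie y \<omega>) k es hs" for k es hs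
    using assms
  proof (induction \<omega> k es hs rule: mixed_induct)
    case (support \<omega> k es hs)
    then show ?case by (auto simp: Lie_apply cochain_scale_apply)
  next
    case (nil \<omega>)
    then show ?case by (simp add: Lie_apply cochain_scale_apply tau_add_left tau_scale_left)
  next
    case (iota \<omega> k e es hs)
    then show ?case
      using mixed_lin[of \<omega> k "[]"]
      by (simp add: Lie_Cons cochain_scale_apply br_lin_left V.scale_right_diff_distrib)
  next
    case (kappa \<omega> k h hs)
    then show ?case
      by (simp add: Lie_Cons_H cochain_scale_apply br_lin_left mixed_lin_H br_H
          V.scale_right_diff_distrib)
  qed
qed

text \<open>Without arguments this is the representation law for \<tau>; each inserted argument
  contributes one instance of the Leibniz identity.\<close>

lemma Lie_commutator:
  assumes "mixed \<omega>"
  shows "Lie x (Lie y \<omega>) - Lie y (Lie x \<omega>) = Lie (br x y) \<omega>"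
proof (intro ext)
  show "(Lie x (Lie y \<omega>) - Lie y (Lie x \<omega>)) k es hs = Lie (br x y) \<omega> k es hs" for k es hs
    using assms
  proof (induction \<omega> k es hs rule: mixed_induct)
    case (support \<omega> k es hs)
    then show ?case by (auto simp: Lie_apply)
  next
    case (nil \<omega>)
    then show ?case by (simp add: Lie_apply tau_br)
  next
    case (iota \<omega> k e es hs)
    have "\<omega> k (br x (br y e) # es) hs = \<omega> k (br (br x y) e # es) hs + \<omega> k (br y (br x e) # es) hs"
      using iota_sum[OF iota.hyps, of "br (br x y) e" "br y (br x e)"]
      by (simp add: leibniz[of x y] fun_eq_iff iota_apply)
    with iota show ?case
      by (simp add: Lie_Cons iota_Lie Lie_diff mixed_Lie mixed_iota algebra_simps)
  next
    case (kappa \<omega> k h hs)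
    have "\<omega> (Suc k) [] (br x (br y h) # hs) =
        \<omega> (Suc k) [] (br (br x y) h # hs) + \<omega> (Suc k) [] (br y (br x h) # hs)"
      using kappa by (simp add: leibniz[of x y] mixed_add_H br_H)
    with kappa show ?case
      by (simp add: Lie_Cons_H kappa_Lie Lie_diff mixed_Lie mixed_kappa br_H
          algebra_simps)
  qed
qed

section \<open>The operator \<open>K\<close>, and \<open>d\<close> on mixed cochains\<close>

lemma K_lin_left:
  assumes "mixed \<omega>" "x \<in> H" "y \<in> H"
  shows "K (sL c x + y) \<omega> = smul c (K x \<omega>) + K y \<omega>"
  using assms
  by (intro ext) (simp add: K_def cochain_scale_apply br_lin_left mixed_lin_H br_H
      V.scale_right_distrib V.scale_sum_right sum.distrib mult.commute[of c])

text \<open>Applied to symmetric products, for which \<open>kappa_d\<close> thus has no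
  \<open>K\<close> term.\<close>

lemma K_left_center:
  assumes "mixed \<omega>" "\<And>e. br z e = 0"
  shows "K z \<omega> = 0"
  using assms by (intro ext) (simp add: K_def mixed_zero_H)

lemma K_swap:
  assumes "mixed \<omega>"
  shows "K h \<omega> k es (as @ x # y # bs) = K h \<omega> k es (as @ y # x # bs)"
  using mixed_swap[OF assms, of _ _ "_ # as"] by (simp add: K_def)

lemma K_Cons_H:
  assumes "mixed \<omega>"
  shows "K h \<omega> (Suc k) es (g # hs) = K h (kappa g \<omega>) k es hs"
  using mixed_swap[OF assms, of _ _ "[]" g] by (simp add: K_def kappa_apply)

lemma mixed_d:
  assumes "mixed \<omega>" shows "mixed (d \<omega>)"
proof (rule mixedI)
  show "d \<omega> k es hs = 0" if "\<not> (length hs = k \<and> set hs \<subseteq> H)" for k es hs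
    unfolding d_apply using that by (rule if_not_P)
  show "d \<omega> k (xs @ (sL c x + y) # ys) hs =
      sV c (d \<omega> k (xs @ x # ys) hs) + d \<omega> k (xs @ y # ys) hs" for k xs ys hs c x y
    using assms
  proof (induction xs arbitrary: \<omega>)
    case Nil
    then show ?case
      by (simp add: d_Cons iota_lin d_add d_scale Lie_lin_left cochain_scale_apply
          V.scale_right_diff_distrib)
  next
    case (Cons w xs)
    then show ?case
      using mixed_lin[OF mixed_Lie, of \<omega> w k xs]
      by (simp add: d_Cons mixed_iota V.scale_right_diff_distrib)
  qed
  show "d \<omega> (Suc k) es ((sL c x + y) # hs) =
      sV c (d \<omega> (Suc k) es (x # hs)) + d \<omega> (Suc k) es (y # hs)"
    if "x \<in> H" "y \<in> H" for k es hs c x y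
    using assms that mixed_lin[of \<omega> k "[]"]
    by (simp add: d_Cons_H lin_H kappa_lin d_add d_scale K_lin_left cochain_scale_apply
        V.scale_right_distrib)
  show "d \<omega> k es (as @ x # y # bs) = d \<omega> k es (as @ y # x # bs)"
    if "x \<in> H" "y \<in> H" "set as \<subseteq> H" "k = length as + Suc (Suc (length bs))" for k es as x y bs
    using assms that(3,4)
  proof (induction as arbitrary: \<omega> k)
    case Nil
    \<comment> \<open>After two applications of \<open>d_Cons_H\<close> the \<open>iota\<close> and
      \<open>K\<close> terms of \<open>x\<close> and \<open>y\<close> just change places.\<close>
    then show ?case
      using that(1,2) kappa_commute[of \<omega> x y]
      by (simp add: d_Cons_H mixed_kappa K_Cons_H kappa_apply)
  next
    case (Cons a as)
    then show ?case
      using mixed_swap[of \<omega> _ "a # es" as x y bs] K_swap[of \<omega> a _ es as x y bs]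
      by (simp add: d_Cons_H mixed_kappa)
  qed
  show "d \<omega> k (xs @ x # y # ys) hs + d \<omega> k (xs @ y # x # ys) hs =
      - d \<omega> (Suc k) (xs @ ys) (sym_prod br x y # hs)" for k xs x y ys hs
    using assms
  proof (induction xs arbitrary: \<omega>)
    case Nil
    \<comment> \<open>Expanding \<open>d\<close> on both orders of x and y, the \<open>Lie\<close>
      terms cancel. What is left is \<open>iota\<close> of the symmetric product and
      \<open>d\<close> of the anticommutator of contractions, which \<open>iota_skew\<close> and
      \<open>kappa_d\<close> turn into the right-hand side.\<close>
    have "\<omega> k (sym_prod br x y # ys) hs = \<omega> k (br x y # ys) hs + \<omega> k (br y x # ys) hs"
      using iota_sum[OF Nil, of "br x y" "br y x"]
      by (simp add: sym_prod_def fun_eq_iff iota_apply)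
    moreover have "d (iota y (iota x \<omega>)) k ys hs + d (iota x (iota y \<omega>)) k ys hs =
        - d (kappa (sym_prod br x y) \<omega>) k ys hs"
      using arg_cong[OF iota_skew[OF Nil, of y x], of "\<lambda>\<psi>. d \<psi> k ys hs"]
      by (simp add: d_add d_minus)
    ultimately show ?case
      using Nil K_left_center[OF Nil sym_prod_left_center]
      by (simp add: d_Cons d_Cons_H Lie_Cons mixed_iota sym_prod_H iota_apply algebra_simps)
  next
    case (Cons w xs)
    from skew_diff[OF mixed_skew[OF mixed_Lie[OF Cons.prems], of w k xs x y ys hs]
        Cons.IH[OF mixed_iota[OF Cons.prems], of w]]
    show ?case by (simp add: d_Cons Cons.prems)
  qed
qed

section \<open>Invariance of \<open>d\<close>, and its square\<close>

lemma Lie_d: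
  assumes "mixed \<omega>"
  shows "Lie x (d \<omega>) = d (Lie x \<omega>)"
proof (intro ext)
  show "Lie x (d \<omega>) k es hs = d (Lie x \<omega>) k es hs" for k es hs
    using assms
  proof (induction \<omega> k es hs rule: mixed_induct)
    case (support \<omega> k es hs)
    then show ?case by (auto simp: Lie_apply d_apply)
  next
    case (nil \<omega>)
    then show ?case by (simp add: Lie_apply d_apply)
  next
    case (iota \<omega> k e es hs)
    \<comment> \<open>Contracting the commutator of \<open>Lie x\<close> and \<open>d\<close> with
      \<open>e\<close> leaves exactly this identity, besides the commutator on
      \<open>iota e \<omega>\<close>.\<close>
    have "Lie x (Lie e \<omega>) k es hs - Lie e (Lie x \<omega>) k es hs = Lie (br x e) \<omega> k es hs"
      by (simp flip: Lie_commutator[OF iota.hyps])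
    with iota show ?case
      by (simp add: Lie_Cons d_Cons iota_Lie iota_d Lie_diff d_diff mixed_Lie mixed_d
          mixed_iota algebra_simps)
  next
    case (kappa \<omega> k h hs)
    have "K g \<psi> l [] gs = 0" for g \<psi> l gs
      by (simp add: K_def)
    moreover from this have "Lie x (K g \<psi>) l [] gs = 0" for g \<psi> l gs
      by (simp add: Lie_apply)
    ultimately show ?case
      using kappa
      by (simp add: Lie_Cons_H d_Cons_H kappa_Lie kappa_d Lie_add d_diff mixed_Lie mixed_d
          mixed_kappa br_H Lie_Cons iota_Lie algebra_simps)
  qed
qed

text \<open>Without \<open>L\<close>-arguments only \<open>delta\<close> acts. It inserts some
  \<open>hs ! j\<close>, which \<open>K h\<close> turns into \<open>br h (hs ! j)\<close>; this is
  minus \<open>Lie h\<close>, whose \<tau>-part is 0.\<close>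

lemma d_K_nil:
  assumes "mixed \<omega>" "h \<in> H"
  shows "d (K h \<omega>) k [] hs = - Lie h \<omega> k [] hs"
proof (cases "length hs = k \<and> set hs \<subseteq> H")
  case True
  \<comment> \<open>\<open>delta\<close> lowers the index and \<open>K\<close> raises it again,
    whence \<open>Suc (k - 1)\<close>.\<close>
  then have "(\<Sum>j<k. \<omega> (Suc (k - 1)) [] (br h (hs ! j) # omit j hs)) =
      (\<Sum>j<k. \<omega> k [] (hs[j := br h (hs ! j)]))"
    by (intro sum.cong) (simp_all add: mixed_update[OF assms(1)])
  then show ?thesis
    using True assms(2) by (simp add: d_apply Lie_apply K_def tau_H)
qed (auto simp: d_apply Lie_apply)

text \<open>Contraction with \<open>e\<close> reduces the claim to \<open>iota e \<omega>\<close>,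
  as \<open>Lie e\<close> commutes with \<open>d\<close>. For \<open>h\<close> the extra terms are
  \<open>d\<close> and \<open>iota h\<close> in both orders, with sum \<open>Lie h\<close>, and
  \<open>d (K h \<omega>)\<close>, which cancels it.\<close>

lemma d_d:
  assumes "mixed \<omega>"
  shows "d (d \<omega>) = 0"
proof (intro ext)
  show "d (d \<omega>) k es hs = (0 :: ('l, 'v) cochain) k es hs" for k es hs
    using assms
  proof (induction \<omega> k es hs rule: mixed_induct)
    case (support \<omega> k es hs)
    then show ?case by (auto simp: d_apply)
  next
    case (nil \<omega>)
    then show ?case by (simp add: d_apply)
  next
    case (iota \<omega> k e es hs)
    then show ?case
      by (simp add: d_Cons iota_d d_diff Lie_d mixed_d)
  next
    case (kappa \<omega> k h hs)
    moreover have "K h (d \<omega>) k [] hs = 0"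
      by (simp add: K_def)
    ultimately show ?case
      by (simp add: d_Cons_H kappa_d d_add d_Cons d_K_nil mixed_d)
  qed
qed

subsection \<open>The cochain spaces\<close>

lemma mixed_zero: "mixed 0"
  by (rule mixedI) simp_all

lemma mixed_add:
  assumes "mixed \<omega>" "mixed \<omega>'" shows "mixed (\<omega> + \<omega>')"
proof (rule mixedI)
  show "(\<omega> + \<omega>') k (xs @ x # y # ys) hs + (\<omega> + \<omega>') k (xs @ y # x # ys) hs =
      - (\<omega> + \<omega>') (Suc k) (xs @ ys) (sym_prod br x y # hs)" for k xs x y ys hs
    using arg_cong2[OF mixed_skew[OF assms(1)] mixed_skew[OF assms(2)], of "(+)" k xs x y ys hs]
    by (simp add: ac_simps)
qed (simp_all add: assms mixed_support mixed_lin mixed_lin_H mixed_swap V.scale_right_distrib)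

lemma mixed_scale:
  assumes "mixed \<omega>" shows "mixed (smul c \<omega>)"
proof (rule mixedI)
  show "smul c \<omega> k (xs @ x # y # ys) hs + smul c \<omega> k (xs @ y # x # ys) hs =
      - smul c \<omega> (Suc k) (xs @ ys) (sym_prod br x y # hs)" for k xs x y ys hs
    using assms by (simp add: cochain_scale_apply mixed_skew flip: V.scale_right_distrib)
qed (use assms in \<open>simp_all add: cochain_scale_apply mixed_support mixed_lin mixed_lin_H mixed_swap
    V.scale_right_distrib mult.commute[of c]\<close>)

lemma linear_slot_iff:
  "Vector_Spaces.linear sL sV f \<longleftrightarrow> (\<forall>c x y. f (sL c x + y) = sV c (f x) + f y)"
proof
  assume "Vector_Spaces.linear sL sV f"
  then interpret f: Vector_Spaces.linear sL sV f .
  show "\<forall>c x y. f (sL c x + y) = sV c (f x) + f y"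
    by (simp add: f.add f.scale)
next
  assume lin: "\<forall>c x y. f (sL c x + y) = sV c (f x) + f y"
  have "f (x + y) = f x + f y" for x y
    using lin[rule_format, of 1 x y] by simp
  \<comment> \<open>Additivity at 0 gives \<open>f 0 = 0\<close>, needed to drop the second
    summand.\<close>
  moreover from this[of 0 0] have "f (sL c x) = sV c (f x)" for c x
    using lin[rule_format, of c x 0] by simp
  ultimately show "Vector_Spaces.linear sL sV f"
    by unfold_locales simp_all
qed

text \<open>The n-th space is the part of degree n, \<open>L\<close>-arguments counting 1 and
  \<open>H\<close>-arguments 2. Off this degree all terms of each law vanish; weak skew-symmetry
  preserves it, trading two \<open>L\<close>-arguments for one in \<open>H\<close>.\<close>

lemma cochains_iff:
  "\<omega> \<in> cochains sL br H sV n \<longleftrightarrow>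
    mixed \<omega> \<and> (\<forall>k es hs. length es + 2 * k \<noteq> n \<longrightarrow> \<omega> k es hs = 0)"
proof
  assume \<omega>: "\<omega> \<in> cochains sL br H sV n"
  note parts = \<omega>[unfolded cochains_def mem_Collect_eq]
  note supp = parts[THEN conjunct1, rule_format]
    and multilinear = parts[THEN conjunct2, THEN conjunct1, rule_format]
    and skew = parts[THEN conjunct2, THEN conjunct2, rule_format]
  note lin = multilinear[THEN conjunct1, rule_format]
    and linH = multilinear[THEN conjunct2, THEN conjunct1, rule_format]
    and sym = multilinear[THEN conjunct2, THEN conjunct2, rule_format]
  have "mixed \<omega>"
  proof (rule mixedI)
    show "\<omega> k es hs = 0" if "\<not> (length hs = k \<and> set hs \<subseteq> H)" for k es hs
      using that by (intro supp) (auto simp: cochain_args_def)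
    show "\<omega> k (xs @ (sL c x + y) # ys) hs =
        sV c (\<omega> k (xs @ x # ys) hs) + \<omega> k (xs @ y # ys) hs" for k xs ys hs c x y
    proof (cases "cochain_args H n k (xs @ x # ys) hs")
      case True
      from lin[OF this, of "length xs"] show ?thesis
        by (simp add: linear_slot_iff)
    qed (simp add: supp cochain_args_def)
    show "\<omega> (Suc k) es ((sL c x + y) # hs) =
        sV c (\<omega> (Suc k) es (x # hs)) + \<omega> (Suc k) es (y # hs)"
      if "x \<in> H" "y \<in> H" for k es hs c x y
    proof (cases "cochain_args H n (Suc k) es (x # hs)")
      case True
      have "sL c x \<in> H"
        using subspace_H that(1) by (rule L.subspace_scale)
      with linH[OF True, of 0 "sL c x" y] linH[OF True, of 0 x y c] that show ?thesis
        by simp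
    qed (use that lin_H in \<open>simp add: supp cochain_args_def\<close>)
    show "\<omega> k es (as @ x # y # bs) = \<omega> k es (as @ y # x # bs)" for k es as x y bs
    proof (cases "cochain_args H n k es (as @ y # x # bs)")
      case True
      then show ?thesis by (rule sym) simp
    next
      case False
      then have "\<not> cochain_args H n k es (as @ x # y # bs)"
        by (auto simp: cochain_args_def)
      with False show ?thesis by (simp add: supp)
    qed
    show "\<omega> k (xs @ x # y # ys) hs + \<omega> k (xs @ y # x # ys) hs =
        - \<omega> (Suc k) (xs @ ys) (sym_prod br x y # hs)" for k xs x y ys hs
    proof (cases "cochain_args H n k (xs @ [x, y] @ ys) hs")
      case True
      from skew[OF this] show ?thesis by simp
    next
      case False
      then have "\<not> cochain_args H n k (xs @ x # y # ys) hs"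
        "\<not> cochain_args H n k (xs @ y # x # ys) hs"
        "\<not> cochain_args H n (Suc k) (xs @ ys) (sym_prod br x y # hs)"
        by (auto simp: cochain_args_def)
      then show ?thesis by (simp add: supp)
    qed
  qed
  then show "mixed \<omega> \<and> (\<forall>k es hs. length es + 2 * k \<noteq> n \<longrightarrow> \<omega> k es hs = 0)"
    using supp by (auto simp: cochain_args_def)
next
  assume \<omega>: "mixed \<omega> \<and> (\<forall>k es hs. length es + 2 * k \<noteq> n \<longrightarrow> \<omega> k es hs = 0)"
  then have m: "mixed \<omega>" by simp
  show "\<omega> \<in> cochains sL br H sV n"
    unfolding cochains_def mem_Collect_eq
  proof (intro conjI allI ballI impI)
    show "\<omega> k es hs = 0" if "\<not> cochain_args H n k es hs" for k es hs
      using that \<omega> mixed_support[OF m, of hs k es] unfolding cochain_args_def by blast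
    show "Vector_Spaces.linear sL sV (\<lambda>x. \<omega> k (es[i := x]) hs)"
      if "i < length es" for k es hs i
      using that mixed_lin[OF m] by (simp add: linear_slot_iff upd_conv_take_nth_drop)
    show "\<omega> k es hs' = \<omega> k es hs" if "mset hs' = mset hs" for k es hs hs'
      using m that by (rule mixed_mset)
    show "\<omega> k (xs @ [x, y] @ ys) hs + \<omega> k (xs @ [y, x] @ ys) hs =
        - \<omega> (Suc k) (xs @ ys) (sym_prod br x y # hs)" for k xs x y ys hs
      using mixed_skew[OF m, of k xs] by simp
    fix k es hs j x y c
    assume args: "cochain_args H n k es hs" and "j < k" and xy: "x \<in> H" "y \<in> H"
    then have j: "j < length hs" by (simp add: cochain_args_def)
    show "\<omega> k es (hs[j := x + y]) = \<omega> k es (hs[j := x]) + \<omega> k es (hs[j := y])"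
      using xy by (simp add: mixed_update[OF m j] mixed_add_H[OF m])
    show "\<omega> k es (hs[j := sL c x]) = sV c (\<omega> k es (hs[j := x]))"
      using mixed_lin_H[OF m xy(1) L.subspace_0[OF subspace_H], of k es c]
      by (simp add: mixed_update[OF m j] mixed_zero_H[OF m])
  qed
qed

text \<open>Each summand evaluates \<omega> one degree lower: one \<open>L\<close>-argument is
  dropped, or \<open>delta\<close> turns an \<open>H\<close>-argument into an
  \<open>L\<close>-argument.\<close>

lemma d_cochains:
  assumes "\<omega> \<in> cochains sL br H sV n"
  shows "d \<omega> \<in> cochains sL br H sV (Suc n)"
proof -
  have "d \<omega> k es hs = 0" if "length es + 2 * k \<noteq> Suc n" for k es hs
  proof -
    have "\<omega> k (omit i es') hs' = 0" if "i < length es" "length es' = length es" for i es' hs'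
      using assms that \<open>length es + 2 * k \<noteq> Suc n\<close> by (simp add: cochains_iff)
    \<comment> \<open>For \<open>k = 0\<close> the truncated \<open>k - 1\<close> would spoil the
      count, but then the sum in \<open>delta\<close> is empty.\<close>
    moreover have "\<omega> (k - 1) (h # es) hs' = 0" if "0 < k" for h hs'
      using assms that \<open>length es + 2 * k \<noteq> Suc n\<close> by (simp add: cochains_iff)
    ultimately show ?thesis by (simp add: d_apply)
  qed
  with assms show ?thesis by (simp add: cochains_iff mixed_d)
qed

lemma vector_space_cochain_scale: "vector_space smul"
  by unfold_locales
    (simp_all add: fun_eq_iff cochain_scale_apply V.scale_right_distrib V.scale_left_distrib)

lemma subspace_cochains: "module.subspace smul (cochains sL br H sV n)"
proof -
  interpret C: vector_space smul by (rule vector_space_cochain_scale)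
  show ?thesis
    by (rule C.subspaceI)
      (simp_all add: cochains_iff mixed_zero mixed_add mixed_scale cochain_scale_apply)
qed

lemma cochain_complex_d: "cochain_complex smul (cochains sL br H sV) d"
  by (simp add: cochain_complex_def vector_space_cochain_scale subspace_cochains d_add d_scale
      d_cochains) (simp add: cochains_iff d_d)

end

theorem theorem3p8:
  fixes sL :: "'k::field \<Rightarrow> 'l::ab_group_add \<Rightarrow> 'l"
    and br :: "'l \<Rightarrow> 'l \<Rightarrow> 'l"
    and H :: "'l set"
    and sV :: "'k \<Rightarrow> 'v::ab_group_add \<Rightarrow> 'v"
    and \<tau> :: "'l \<Rightarrow> 'v \<Rightarrow> 'v"
  assumes "real_or_complex_field TYPE('k)"
    and "leibniz_algebra sL br"
    and "isotropic_ideal sL br H"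
    and "left_center br \<subseteq> H"
    and "H_representation sL br H sV \<tau>"
  shows "cochain_complex (cochain_scale sV) (cochains sL br H sV) (differential br H sV \<tau>)"
proof -
  interpret L: vector_space sL
    using assms(2) by (simp add: leibniz_algebra_def)
  interpret V: vector_space sV
    using assms(5) by (simp add: H_representation_def)
  interpret br_right: Vector_Spaces.linear sL sL "br x" for x
    using assms(2) by (simp add: leibniz_algebra_def)
  interpret br_left: Vector_Spaces.linear sL sL "\<lambda>x. br x y" for y
    using assms(2) by (simp add: leibniz_algebra_def)
  interpret tau: Vector_Spaces.linear sV sV "\<tau> x" for x
    using assms(5) by (simp add: H_representation_def)
  interpret tau_left: Vector_Spaces.linear sL sV "\<lambda>x. \<tau> x v" for v
    using assms(5) by (simp add: H_representation_def)
  interpret leibniz_representation sL sV br H \<tau>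
  proof unfold_locales
    show "br x (br y z) = br (br x y) z + br y (br x z)" for x y z
      using assms(2) unfolding leibniz_algebra_def by blast
    show "\<tau> (br x y) v = \<tau> x (\<tau> y v) - \<tau> y (\<tau> x v)" for x y v
      using assms(5) unfolding H_representation_def by blast
  qed (use assms(3-5) in \<open>simp_all add: isotropic_ideal_def H_representation_def br_right.add
      br_right.scale br_left.add br_left.scale tau.add tau.scale tau_left.add tau_left.scale\<close>)
  show ?thesis by (rule cochain_complex_d)
qed

end
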